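(* Let $\mathcal{S}$ be a nonempty set with a scene space basis $\mathcal{B}$, let $V$ be a set and $e:\mathcal{S}\to V$ an expression. Then $FV(e)$ is the smallest set of variables with the coincidence effect property for $e$. That is: (1) for all $s,s'\in\mathcal{S}$, if $s\approx s'$ on $\bigcup FV(e)$ then $e(s)=e(s')$; and (2) if $T\subseteq\mathcal{B}$ is such that for all $s,s'\in\mathcal{S}$, $s\approx s'$ on $\bigcup T$ implies $e(s)=e(s')$, then $FV(e)\subseteq T$.
   Context: Scenes. Let $\mathcal{S}$ be a nonempty set (of states). A scene on $\mathcal{S}$ is a function $A:\mathcal{S}\to\mathcal{S}\to\mathcal{S}$ satisfying for all $x,y,z$: $A\,(A\,x\,y)\,z = A\,x\,z$, $A\,x\,(A\,y\,z)=A\,x\,z$, $A\,x\,x=x$. Write $\bot = (\lambda s_1\,s_2.\ s_1)$, $\top=(\lambda s_1\,s_2.\ s_2)$, $A^{\complement}=(\lambda s_1\,s_2.\ A\,s_2\,s_1)$, $A\sqcup B=(\lambda s_1\,s_2.\ B\,(A\,s_1\,s_2)\,s_2)$. Scenes $A,B$ are independent if $B\,(A\,s_1\,s_2)\,s_3=A\,(B\,s_1\,s_3)\,s_2$ for all $s_1,s_2,s_3$. Write "$s_1\approx s_2$ on $A$" for $A\,s_1\,s_2=s_1$. A scene space basis is a finite sequence of scenes $S_1,\dots,S_n$ with $S_i,S_j$ independent for $i\neq j$ and $S_1\sqcup\cdots\sqcup S_n=\top$; $\mathcal{B}=\{S_1,\dots,S_n\}$ (the variables). For a set $X\subseteq\mathcal{B}$,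 $\bigcup X$ denotes the $\sqcup$ of all its elements (in any order, the result being independent of it), with $\bigcup\emptyset=\bot$. Free variables: $FV(e)=\{x\in\mathcal{B} : \exists s,s'.\ s\approx s' \text{ on } x^{\complement} \text{ and } e(s)\ne e(s')\}$. *)

theory Defs imports Main begin

type_synonym 's scene = "'s \<Rightarrow> 's \<Rightarrow> 's"

definition is_scene :: "'s scene \<Rightarrow> bool" where
  "is_scene A \<longleftrightarrow> (\<forall>x y z. A (A x y) z = A x z \<and> A x (A y z) = A x z \<and> A x x = x)"

definition scene_bot :: "'s scene" ("\<bottom>\<^sub>S") where
  "\<bottom>\<^sub>S = (\<lambda>s\<^sub>1 s\<^sub>2. s\<^sub>1)"

definition scene_top :: "'s scene" ("\<top>\<^sub>S") where
  "\<top>\<^sub>S = (\<lambda>s\<^sub>1 s\<^sub>2. s\<^sub>2)"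

definition scene_compl :: "'s scene \<Rightarrow> 's scene" where
  "scene_compl A = (\<lambda>s\<^sub>1 s\<^sub>2. A s\<^sub>2 s\<^sub>1)"

definition scene_sup :: "'s scene \<Rightarrow> 's scene \<Rightarrow> 's scene" (infixr "\<squnion>\<^sub>S" 65) where
  "A \<squnion>\<^sub>S B = (\<lambda>s\<^sub>1 s\<^sub>2. B (A s\<^sub>1 s\<^sub>2) s\<^sub>2)"

definition scene_indep :: "'s scene \<Rightarrow> 's scene \<Rightarrow> bool" where
  "scene_indep A B \<longleftrightarrow> (\<forall>s\<^sub>1 s\<^sub>2 s\<^sub>3. B (A s\<^sub>1 s\<^sub>2) s\<^sub>3 = A (B s\<^sub>1 s\<^sub>3) s\<^sub>2)"

text \<open>\<^term>\<open>scene_eq A s\<^sub>1 s\<^sub>2\<close> renders ``\<open>s\<^sub>1 \<approx> s\<^sub>2\<close> on \<open>A\<close>''.\<close>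

definition scene_eq :: "'s scene \<Rightarrow> 's \<Rightarrow> 's \<Rightarrow> bool" where
  "scene_eq A s\<^sub>1 s\<^sub>2 \<longleftrightarrow> A s\<^sub>1 s\<^sub>2 = s\<^sub>1"

text \<open>Independence is required between distinct positions of the sequence, not only between
  distinct scenes. The bracketing in the join is immaterial because \<open>\<squnion>\<^sub>S\<close> is associative with unit
  \<open>\<bottom>\<^sub>S\<close>.\<close>

definition scene_basis :: "'s scene list \<Rightarrow> bool" where
  "scene_basis Ss \<longleftrightarrow>
     (\<forall>A \<in> set Ss. is_scene A) \<and>
     (\<forall>i < length Ss. \<forall>j < length Ss. i \<noteq> j \<longrightarrow> scene_indep (Ss ! i) (Ss ! j)) \<and>
     foldr (\<squnion>\<^sub>S) Ss \<bottom>\<^sub>S = \<top>\<^sub>S"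

text \<open>\<^const>\<open>Finite_Set.fold\<close> is meaningful only if the order of the elements does not matter; for
  pairwise independent scenes this is \<open>scene_Union_set\<close> below.\<close>

definition scene_Union :: "'s scene set \<Rightarrow> 's scene" ("\<Union>\<^sub>S") where
  "\<Union>\<^sub>S X = Finite_Set.fold (\<squnion>\<^sub>S) \<bottom>\<^sub>S X"

lemma scene_Union_set:
  assumes "distinct xs" and "pairwise scene_indep (set xs)"
  shows "\<Union>\<^sub>S (set xs) = foldr (\<squnion>\<^sub>S) xs \<bottom>\<^sub>S"
  using assms
proof (induction xs)
  case Nil
  then show ?case by (simp add: scene_Union_def)
next
  case (Cons x xs)
  interpret comp_fun_commute_on "set (x # xs)" "(\<squnion>\<^sub>S)"
  proof
    fix A B :: "'a scene"
    assume "A \<in> set (x # xs)" "B \<in> set (x # xs)"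
    then have "A = B \<or> scene_indep A B"
      using Cons.prems(2) by (auto simp: pairwise_def)
    then show "(\<squnion>\<^sub>S) B \<circ> (\<squnion>\<^sub>S) A = (\<squnion>\<^sub>S) A \<circ> (\<squnion>\<^sub>S) B"
      by (auto simp: scene_indep_def scene_sup_def fun_eq_iff)
  qed
  have "\<Union>\<^sub>S (set (x # xs)) = x \<squnion>\<^sub>S \<Union>\<^sub>S (set xs)"
    using Cons.prems(1) by (simp add: scene_Union_def fold_insert)
  moreover have "pairwise scene_indep (set xs)"
    using Cons.prems(2) by (rule pairwise_mono) auto
  ultimately show ?case
    using Cons.IH Cons.prems(1) by simp
qed

lemma scene_basis_pairwise:
  assumes "scene_basis Ss" and "X \<subseteq> set Ss"
  shows "pairwise scene_indep X"
proof (rule pairwiseI)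
  fix A B assume "A \<in> X" "B \<in> X" "A \<noteq> B"
  then obtain i j where "i < length Ss" "Ss ! i = A" "j < length Ss" "Ss ! j = B"
    using assms(2) by (metis in_set_conv_nth subsetD)
  with \<open>A \<noteq> B\<close> assms(1) show "scene_indep A B"
    by (auto simp: scene_basis_def)
qed

definition FV :: "'s scene set \<Rightarrow> ('s \<Rightarrow> 'v) \<Rightarrow> 's scene set" where
  "FV B e = {x \<in> B. \<exists>s s'. scene_eq (scene_compl x) s s' \<and> e s \<noteq> e s'}"

end

(* (1) Overwrite s by s' one variable at a time: a variable in FV(e) changes nothing, because s and s'
   agree on it, and a variable outside FV(e) does not change the value of e; the end result is s'.
   (2) Two states that differ only in x agree on every variable other than x, hence on T if x is not in T. *)

theory Submission imports Defs begin

lemma scene_idem: "is_scene A \<Longrightarrow> A (A s t) t = A s t"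
  by (simp add: is_scene_def)

lemma scene_indep_commute: "scene_indep A B \<Longrightarrow> B (A s t) u = A (B s u) t"
  by (simp add: scene_indep_def)

lemma foldr_scene_sup_Cons:
  "foldr (\<squnion>\<^sub>S) (A # As) \<bottom>\<^sub>S s t = foldr (\<squnion>\<^sub>S) As \<bottom>\<^sub>S (A s t) t"
  by (simp add: scene_sup_def)

text \<open>Once \<open>A\<close> has been written from \<open>t\<close>, later writes from
  \<open>t\<close> cannot undo it: those by other scenes of the list commute with \<open>A\<close>,
  and a repeated write of \<open>A\<close> is idempotent.\<close>

lemma foldr_scene_sup_absorb:
  assumes "\<And>A. A \<in> set As \<Longrightarrow> is_scene A" "pairwise scene_indep (set As)" "A \<in> set As"
  shows "A (foldr (\<squnion>\<^sub>S) As \<bottom>\<^sub>S s t) t = foldr (\<squnion>\<^sub>S) As \<bottom>\<^sub>S s t"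
proof -
  \<comment> \<open>The head of the list acts first, so the start state \<open>u\<close> moves along
    the induction. The disjunction is the invariant: \<open>A\<close> is still to be written, or the
    current state already agrees with \<open>t\<close> on \<open>A\<close>.\<close>
  have keep: "A (foldr (\<squnion>\<^sub>S) Bs \<bottom>\<^sub>S u t) t = foldr (\<squnion>\<^sub>S) Bs \<bottom>\<^sub>S u t"
    if "set Bs \<subseteq> set As" "A \<in> set Bs \<or> A u t = u" for Bs u
    using that
  proof (induction Bs arbitrary: u)
    case Nil
    then show ?case by (simp add: scene_bot_def)
  next
    case (Cons B Bs)
    have "A \<in> set Bs \<or> A (B u t) t = B u t"
    proof (cases "A = B")
      case True
      then show ?thesis using assms(1,3) by (simp add: scene_idem)
    next
      case False
      then have "scene_indep B A"
        using assms(2,3) Cons.prems(1) by (auto simp: pairwise_def)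
      then show ?thesis
        using Cons.prems(2) False by (metis scene_indep_commute set_ConsD)
    qed
    then show ?case
      using Cons.IH Cons.prems(1) unfolding foldr_scene_sup_Cons by simp
  qed
  show ?thesis using keep[of As s] assms(3) by simp
qed

lemma foldr_scene_sup_unchanged:
  "(\<And>A. A \<in> set As \<Longrightarrow> A s t = s) \<Longrightarrow> foldr (\<squnion>\<^sub>S) As \<bottom>\<^sub>S s t = s"
proof (induction As)
  case Nil
  then show ?case by (simp add: scene_bot_def)
next
  case (Cons A As)
  have "A s t = s" using Cons.prems by simp
  moreover have "foldr (\<squnion>\<^sub>S) As \<bottom>\<^sub>S s t = s"
    using Cons by simp
  ultimately show ?case unfolding foldr_scene_sup_Cons by simp
qed

text \<open>Reduces agreement on a join to agreement on each variable. If the join fixes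
  \<open>s\<close>, absorption gives \<open>A s t = s\<close> for every member; conversely, if every
  member fixes \<open>s\<close>, no write in the fold changes it.\<close>

lemma scene_eq_Union_iff:
  assumes "finite X" "\<And>A. A \<in> X \<Longrightarrow> is_scene A" "pairwise scene_indep X"
  shows "scene_eq (\<Union>\<^sub>S X) s t \<longleftrightarrow> (\<forall>A\<in>X. scene_eq A s t)"
proof -
  obtain As where As: "set As = X" "distinct As"
    using assms(1) finite_distinct_list by blast
  then have "\<Union>\<^sub>S X = foldr (\<squnion>\<^sub>S) As \<bottom>\<^sub>S"
    using assms(3) scene_Union_set by blast
  then show ?thesis
    using foldr_scene_sup_absorb[of As _ s t] foldr_scene_sup_unchanged[of As s t] As(1) assms(2,3)
    unfolding scene_eq_def by metis
qed

lemma scene_eq_basis_Union_iff: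
  assumes "scene_basis Ss" "X \<subseteq> set Ss"
  shows "scene_eq (\<Union>\<^sub>S X) s t \<longleftrightarrow> (\<forall>A\<in>X. scene_eq A s t)"
proof (rule scene_eq_Union_iff)
  show "finite X" using assms(2) finite_subset by blast
  show "is_scene A" if "A \<in> X" for A
    using that assms by (auto simp: scene_basis_def)
  show "pairwise scene_indep X" using assms by (rule scene_basis_pairwise)
qed

lemma overwrite_non_FV:
  assumes "is_scene A" "A \<in> B" "A \<notin> FV B e"
  shows "e (A s t) = e s"
proof -
  \<comment> \<open>The complement swaps the arguments, so this is the scene law
    \<open>A s (A s t) = A s t\<close>.\<close>
  have "scene_eq (scene_compl A) (A s t) s"
    using assms(1) by (simp add: scene_eq_def scene_compl_def is_scene_def)
  then show ?thesis using assms(2,3) by (auto simp: FV_def)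
qed

lemma FV_coincidence:
  assumes basis: "scene_basis Ss" and agree: "\<And>A. A \<in> FV (set Ss) e \<Longrightarrow> scene_eq A s t"
  shows "e s = e t"
proof -
  have indep: "pairwise scene_indep (set Ss)"
    using basis by (rule scene_basis_pairwise) simp
  have scene: "is_scene A" if "A \<in> set Ss" for A
    using that basis by (simp add: scene_basis_def)
  \<comment> \<open>Generalised to any list of variables and any intermediate state \<open>u\<close>
    that agrees with \<open>t\<close> on \<open>FV (set Ss) e\<close>; each write has to preserve
    this agreement.\<close>
  have "e u = e (foldr (\<squnion>\<^sub>S) As \<bottom>\<^sub>S u t)"
    if "set As \<subseteq> set Ss" "\<forall>A\<in>FV (set Ss) e. A u t = u" for As u
    using that
  proof (induction As arbitrary: u)
    case Nil
    then show ?case by (simp add: scene_bot_def)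
  next
    case (Cons B As)
    have B: "B \<in> set Ss" using Cons.prems(1) by simp
    have "A (B u t) t = B u t" if A: "A \<in> FV (set Ss) e" for A
    proof (cases "A = B")
      case True
      then show ?thesis using B scene by (simp add: scene_idem)
    next
      case False
      then have "scene_indep B A"
        using A B indep by (auto simp: FV_def pairwise_def)
      then show ?thesis using A Cons.prems(2) by (metis scene_indep_commute)
    qed
    then have "e (B u t) = e (foldr (\<squnion>\<^sub>S) (B # As) \<bottom>\<^sub>S u t)"
      using Cons.IH Cons.prems(1) unfolding foldr_scene_sup_Cons by simp
    \<comment> \<open>If \<open>B\<close> is free in \<open>e\<close>, then \<open>B u t = u\<close>
      by the invariant; otherwise \<open>overwrite_non_FV\<close> applies.\<close>
    moreover have "e (B u t) = e u"
      using Cons.prems(2) B scene overwrite_non_FV by metis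
    ultimately show ?case by simp
  qed
  \<comment> \<open>The join of the whole basis is top, so the overwriting ends in
    \<open>t\<close>.\<close>
  moreover have "foldr (\<squnion>\<^sub>S) Ss \<bottom>\<^sub>S s t = t"
    using basis by (simp add: scene_basis_def scene_top_def)
  ultimately show ?thesis
    using agree by (metis order_refl scene_eq_def)
qed

text \<open>Agreement off \<open>A\<close> says that \<open>s\<close> is \<open>t\<close> with
  \<open>A\<close> overwritten from \<open>s\<close>. Writing \<open>B\<close> from \<open>t\<close>
  commutes with this overwriting and does nothing to \<open>t\<close> itself.\<close>

lemma scene_eq_compl_imp_eq_indep:
  assumes "scene_indep A B" "is_scene B" "scene_eq (scene_compl A) s t"
  shows "scene_eq B s t"
proof -
  have s: "A t s = s"
    using assms(3) by (simp add: scene_eq_def scene_compl_def)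
  have "B (A t s) t = A (B t t) s"
    using assms(1) by (rule scene_indep_commute)
  also have "B t t = t" using assms(2) by (simp add: is_scene_def)
  finally show ?thesis using s by (simp add: scene_eq_def)
qed

theorem lemma30:
  fixes Ss :: "'s scene list" and e :: "'s \<Rightarrow> 'v"
  assumes "scene_basis Ss"
  shows "(\<forall>s s'. scene_eq (\<Union>\<^sub>S (FV (set Ss) e)) s s' \<longrightarrow> e s = e s') \<and>
         (\<forall>T \<subseteq> set Ss. (\<forall>s s'. scene_eq (\<Union>\<^sub>S T) s s' \<longrightarrow> e s = e s') \<longrightarrow> FV (set Ss) e \<subseteq> T)"
proof (intro conjI allI impI)
  fix s s'
  have "FV (set Ss) e \<subseteq> set Ss" by (auto simp: FV_def)
  moreover assume "scene_eq (\<Union>\<^sub>S (FV (set Ss) e)) s s'"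
  ultimately show "e s = e s'"
    using assms FV_coincidence scene_eq_basis_Union_iff by metis
next
  fix T
  assume T: "T \<subseteq> set Ss" and coincidence: "\<forall>s s'. scene_eq (\<Union>\<^sub>S T) s s' \<longrightarrow> e s = e s'"
  show "FV (set Ss) e \<subseteq> T"
  proof (rule subsetI, rule ccontr)
    fix A assume "A \<in> FV (set Ss) e" and "A \<notin> T"
    then obtain s s' where A: "A \<in> set Ss" and eq: "scene_eq (scene_compl A) s s'"
      and neq: "e s \<noteq> e s'"
      by (auto simp: FV_def)
    have "scene_eq B s s'" if "B \<in> T" for B
    proof (rule scene_eq_compl_imp_eq_indep[OF _ _ eq])
      \<comment> \<open>\<open>A\<close> and \<open>B\<close> are distinct because only
        \<open>B\<close> lies in \<open>T\<close>.\<close>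
      show "scene_indep A B"
        using scene_basis_pairwise[OF assms order_refl] A T that \<open>A \<notin> T\<close>
        by (metis pairwiseD subsetD)
      show "is_scene B" using assms T that by (auto simp: scene_basis_def)
    qed
    then have "scene_eq (\<Union>\<^sub>S T) s s'"
      using scene_eq_basis_Union_iff[OF assms T] by blast
    then show False using coincidence neq by blast
  qed
qed

end
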